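(* For all non-negative integers $n_0,n_1,n_2$, $$\tilde{\alpha}(0^{n_0},1^{n_1},2^{n_2})\geq \frac{3}{4}n_0+\frac{1}{2}(n_1+n_2)-\frac{7}{4}.$$
   Context: All graphs are finite, simple and undirected. For a bipartite graph $G$ with (fixed) partite sets $A$ and $B$, a bihole of order $k$ is an independent set $I$ of $G$ with $|I\cap A|=|I\cap B|=k$. For non-negative integers $d_1<d_2<\dots<d_\ell$ and non-negative integers $n_1,\dots,n_\ell$, $\tilde{\alpha}(d_1^{n_1},\dots,d_\ell^{n_\ell})$ denotes the largest integer $k$ such that every bipartite graph $G$ with partite sets $A$ and $B$ satisfying $|A|=|B|=n_1+\dots+n_\ell$ and $|\{u\in A: d_G(u)=d_i\}|=n_i$ for every $i\in\{1,\dots,\ell\}$ has a bihole of order $k$. Here $\tilde{\alpha}(0^{n_0},1^{n_1},2^{n_2})$ is this quantity with degrees $0,1,2$ and multiplicities $n_0,n_1,n_2$. *)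

theory Defs
  imports Complex_Main
begin

definition simple_graph :: "'a set \<Rightarrow> 'a set set \<Rightarrow> bool" where
  "simple_graph V E \<longleftrightarrow> finite V \<and> (\<forall>e\<in>E. e \<subseteq> V \<and> card e = 2)"

definition bipartite_graph :: "'a set \<Rightarrow> 'a set \<Rightarrow> 'a set set \<Rightarrow> bool" where
  "bipartite_graph A B E \<longleftrightarrow>
     simple_graph (A \<union> B) E \<and> A \<inter> B = {} \<and> (\<forall>e\<in>E. \<exists>a\<in>A. \<exists>b\<in>B. e = {a, b})"

definition degree :: "'a set set \<Rightarrow> 'a \<Rightarrow> nat" where
  "degree E u = card {e\<in>E. u \<in> e}"

definition independent_set :: "'a set \<Rightarrow> 'a set set \<Rightarrow> 'a set \<Rightarrow> bool" where
  "independent_set V E I \<longleftrightarrow> I \<subseteq> V \<and> (\<forall>e\<in>E. \<not> e \<subseteq> I)"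

definition has_bihole :: "'a set \<Rightarrow> 'a set \<Rightarrow> 'a set set \<Rightarrow> nat \<Rightarrow> bool" where
  "has_bihole A B E k \<longleftrightarrow>
     (\<exists>I. independent_set (A \<union> B) E I \<and> card (I \<inter> A) = k \<and> card (I \<inter> B) = k)"

text \<open>The list \<open>[(d\<^sub>1, n\<^sub>1), \<dots>, (d\<^sub>l, n\<^sub>l)]\<close> stands for \<open>d\<^sub>1\<^bsup>n\<^sub>1\<^esup>, \<dots>, d\<^sub>l\<^bsup>n\<^sub>l\<^esup>\<close>, where
  \<open>d\<^sub>1 < \<dots> < d\<^sub>l\<close>. Degrees are prescribed only for the vertices in \<open>A\<close>.\<close>

definition realizes :: "'a set \<Rightarrow> 'a set \<Rightarrow> 'a set set \<Rightarrow> (nat \<times> nat) list \<Rightarrow> bool" where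
  "realizes A B E ds \<longleftrightarrow>
     bipartite_graph A B E \<and>
     card A = (\<Sum>(d, n)\<leftarrow>ds. n) \<and> card B = (\<Sum>(d, n)\<leftarrow>ds. n) \<and>
     (\<forall>(d, n)\<in>set ds. card {u\<in>A. degree E u = d} = n)"

text \<open>Vertices are natural numbers, which is no restriction for finite graphs: see
  \<open>realizes_has_bihole_any_type\<close> below. If \<open>ds\<close> is not realized by any graph (for
  degrees 0, 1, 2 this happens only for a single vertex of degree 2 in \<open>A\<close>), there is no
  largest \<open>k\<close> and the value is an unspecified natural number.\<close>

definition alpha_tilde :: "(nat \<times> nat) list \<Rightarrow> nat" where
  "alpha_tilde ds =
     (GREATEST k. \<forall>(A :: nat set) B E. realizes A B E ds \<longrightarrow> has_bihole A B E k)"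

lemma realizes_has_bihole_any_type:
  fixes A B :: "'a set"
  assumes all: "\<forall>(A :: nat set) B E. realizes A B E ds \<longrightarrow> has_bihole A B E k"
    and r: "realizes A B E ds"
  shows "has_bihole A B E k"
proof -
  have bg: "bipartite_graph A B E" using r by (simp add: realizes_def)
  then have fin: "finite (A \<union> B)" and sub: "\<And>e. e \<in> E \<Longrightarrow> e \<subseteq> A \<union> B"
    and c2: "\<And>e. e \<in> E \<Longrightarrow> card e = 2" and disj: "A \<inter> B = {}"
    and ab: "\<And>e. e \<in> E \<Longrightarrow> \<exists>a\<in>A. \<exists>b\<in>B. e = {a, b}"
    by (auto simp: bipartite_graph_def simple_graph_def)
  obtain f :: "'a \<Rightarrow> nat" where f: "inj_on f (A \<union> B)"
    using finite_imp_inj_to_nat_seg[OF fin] by blast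
  let ?E = "(\<lambda>e. f ` e) ` E"
  have injE: "inj_on (\<lambda>e. f ` e) E"
  proof (rule inj_onI)
    fix e e' assume "e \<in> E" "e' \<in> E" "f ` e = f ` e'"
    then show "e = e'" using inj_on_image_eq_iff[OF f sub sub] by simp
  qed
  have mem: "f u \<in> f ` e \<longleftrightarrow> u \<in> e" if "e \<in> E" "u \<in> A \<union> B" for e u
    using inj_on_image_mem_iff[OF f that(2) sub[OF that(1)]] .
  have deg: "degree ?E (f u) = degree E u" if u: "u \<in> A \<union> B" for u
  proof -
    have "{e\<in>?E. f u \<in> e} = (\<lambda>e. f ` e) ` {e\<in>E. u \<in> e}"
      using mem u by auto
    moreover have "inj_on (\<lambda>e. f ` e) {e\<in>E. u \<in> e}"
      using injE by (rule inj_on_subset) auto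
    ultimately show ?thesis by (simp add: degree_def card_image)
  qed
  have cimg: "card (f ` X) = card X" if "X \<subseteq> A \<union> B" for X
    by (rule card_image[OF inj_on_subset[OF f that]])
  have "bipartite_graph (f ` A) (f ` B) ?E"
    unfolding bipartite_graph_def simple_graph_def
  proof (intro conjI ballI)
    show "finite (f ` A \<union> f ` B)" using fin by simp
    show "f ` A \<inter> f ` B = {}"
      using inj_on_image_Int[OF f, of A B] disj by simp
    fix e' assume "e' \<in> ?E"
    then obtain e where e: "e \<in> E" "e' = f ` e" by blast
    show "e' \<subseteq> f ` A \<union> f ` B" using sub[OF e(1)] e(2) by blast
    show "card e' = 2" using cimg[OF sub[OF e(1)]] c2[OF e(1)] e(2) by simp
    show "\<exists>a\<in>f ` A. \<exists>b\<in>f ` B. e' = {a, b}" using ab[OF e(1)] e(2) by auto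
  qed
  moreover have "card {u\<in>f ` A. degree ?E u = d} = card {u\<in>A. degree E u = d}" for d
  proof -
    have "{u\<in>f ` A. degree ?E u = d} = f ` {u\<in>A. degree E u = d}"
      using deg by auto
    moreover have "{u\<in>A. degree E u = d} \<subseteq> A \<union> B" by blast
    ultimately show ?thesis using cimg by simp
  qed
  ultimately have "realizes (f ` A) (f ` B) ?E ds"
    using r cimg[of A] cimg[of B] by (simp add: realizes_def)
  with all have "has_bihole (f ` A) (f ` B) ?E k" by simp
  then obtain I where I: "I \<subseteq> f ` A \<union> f ` B" "\<forall>e\<in>?E. \<not> e \<subseteq> I"
    "card (I \<inter> f ` A) = k" "card (I \<inter> f ` B) = k"
    unfolding has_bihole_def independent_set_def by (elim exE conjE)
  define J where "J = {u\<in>A \<union> B. f u \<in> I}"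
  have "f ` (J \<inter> A) = I \<inter> f ` A" "f ` (J \<inter> B) = I \<inter> f ` B"
    by (auto simp: J_def)
  then have "card (J \<inter> A) = k" "card (J \<inter> B) = k"
    using I(3,4) cimg[of "J \<inter> A"] cimg[of "J \<inter> B"] by (simp_all add: le_infI2)
  moreover have "independent_set (A \<union> B) E J"
    using I(2) by (simp add: independent_set_def J_def image_subset_iff subset_iff) blast
  ultimately show ?thesis unfolding has_bihole_def by blast
qed

end

theory Submission
  imports Defs
begin

text \<open>Read \<open>B\<close> as the vertex set of a multigraph \<open>H\<close> whose edges (or loops) are the
  neighbourhoods of the vertices of \<open>A\<close> of positive degree; it has \<open>N = n\<^sub>0 + m\<close> vertices and
  \<open>m = n\<^sub>1 + n\<^sub>2\<close> edges. A bihole of order \<open>k\<close> exists as soon as some set of \<open>N - k\<close> vertices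
  spans at least \<open>k - n\<^sub>0\<close> edges of \<open>H\<close>. A multigraph with \<open>m \<le> N\<close> has, for every \<open>s \<le> N\<close>,
  a set of \<open>s\<close> vertices spanning at least \<open>s m / N - 1\<close> edges: a connected multigraph has \<open>s\<close>
  vertices spanning \<open>s - 1\<close> edges, and a disconnected one splits into two parts, of which the
  denser is used up first. With \<open>s = N - k\<close> the bound follows by arithmetic.\<close>

section \<open>Vertex sets spanning many edges of a multigraph\<close>

text \<open>Elements of \<open>A\<close> name edges and \<open>f u\<close> is the set of ends of
  \<open>u\<close>. Counting names instead of end sets keeps parallel edges apart, and a loop is a
  \<open>u\<close> with \<open>f u\<close> a singleton.\<close>

definition spanned :: "'u set \<Rightarrow> ('u \<Rightarrow> 'b set) \<Rightarrow> 'b set \<Rightarrow> 'u set" where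
  "spanned A f S = {u \<in> A. f u \<subseteq> S}"

lemma spanned_subset: "spanned A f S \<subseteq> A"
  by (auto simp: spanned_def)

lemma finite_spanned: "finite A \<Longrightarrow> finite (spanned A f S)"
  by (auto simp: spanned_def)

text \<open>Grow \<open>S\<close> one vertex at a time. While \<open>S\<close> is nonempty and
  proper, \<open>conn\<close> supplies an edge leaving \<open>S\<close>, and adding its outer end
  gains that edge. Only the first vertex may gain nothing, hence the \<open>+ 1\<close>.\<close>

lemma connected_spanned:
  assumes fin: "finite A" "finite B"
    and size: "\<And>u. u \<in> A \<Longrightarrow> f u \<subseteq> B \<and> card (f u) \<le> 2"
    and conn: "\<And>T. T \<subseteq> B \<Longrightarrow> T \<noteq> {} \<Longrightarrow> T \<noteq> B \<Longrightarrow> \<exists>u\<in>A. \<not> f u \<subseteq> T \<and> \<not> f u \<subseteq> B - T"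
    and "s \<le> card B"
  shows "\<exists>S\<subseteq>B. card S = s \<and> s \<le> card (spanned A f S) + 1"
  using \<open>s \<le> card B\<close>
proof (induction s)
  case 0
  show ?case by (intro exI[of _ "{}"]) simp
next
  case (Suc s)
  then obtain S where S: "S \<subseteq> B" "card S = s" "s \<le> card (spanned A f S) + 1" by auto
  have ne: "S \<noteq> B" using S Suc.prems by auto
  show ?case
  proof (cases "S = {}")
    case True
    then obtain v where "v \<in> B" using ne S by auto
    then show ?thesis using S True by (intro exI[of _ "{v}"]) auto
  next
    case False
    obtain u where u: "u \<in> A" "\<not> f u \<subseteq> S" "\<not> f u \<subseteq> B - S"
      using conn[OF S(1) False ne] by auto
    obtain v where v: "v \<in> f u" "v \<notin> S" using u by auto
    obtain t where t: "t \<in> f u" "t \<in> S" using u size by blast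
    have fu: "finite (f u)" using size[OF u(1)] fin finite_subset by blast
    have "t \<noteq> v" using t v by auto
    then have "card {t, v} = 2" by simp
    then have "{t, v} = f u"
      using card_seteq[OF fu, of "{t, v}"] t v size[OF u(1)] by auto
    then have fuS: "f u \<subseteq> insert v S" using t by auto
    have "insert u (spanned A f S) \<subseteq> spanned A f (insert v S)"
      using u(1) fuS by (auto simp: spanned_def)
    then have "card (insert u (spanned A f S)) \<le> card (spanned A f (insert v S))"
      by (rule card_mono[OF finite_spanned[OF fin(1)]])
    moreover have "card (insert u (spanned A f S)) = Suc (card (spanned A f S))"
      using u(2) finite_spanned[OF fin(1), of f S] by (simp add: spanned_def)
    moreover have "card (insert v S) = Suc s"
      using S v fin finite_subset[OF S(1)] by simp
    moreover have "v \<in> B" using v size u(1) by blast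
    ultimately show ?thesis using S by (intro exI[of _ "insert v S"]) auto
  qed
qed

text \<open>Linear interpolation, cleared of denominators: \<open>ma + (s - a) * mb / b\<close> is
  affine in \<open>s\<close>. At \<open>s = a\<close> it is at least the average share by the first
  hypothesis, and at \<open>s = a + b\<close> it equals \<open>ma + mb\<close>, so it dominates the
  average share in between.\<close>

lemma interpolation_arith:
  fixes a b ma mb s e :: nat
  assumes "a * (ma + mb) \<le> (a + b) * ma" and "s \<le> a + b" "a \<le> s" "0 < b"
    and "(s - a) * mb \<le> b * (e + 1)"
  shows "s * (ma + mb) \<le> (a + b) * (ma + e + 1)"
proof -
  obtain d where d: "s = a + d" using \<open>a \<le> s\<close> le_Suc_ex by blast
  then obtain r where r: "b = d + r" using \<open>s \<le> a + b\<close> le_Suc_ex by auto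
  have 1: "a * mb \<le> b * ma" using assms(1) by (simp add: algebra_simps)
  have 2: "d * mb \<le> b * (e + 1)" using assms d by simp
  \<comment> \<open>The distances \<open>r\<close> and \<open>d\<close> of \<open>s\<close> from the
    two ends of the interval act as interpolation weights. The term with \<open>r * (b * ma)\<close>
    stands on the left to avoid subtraction in \<open>nat\<close>.\<close>
  have "b * (s * (ma + mb)) + r * (b * ma) = (a + b) * (b * ma) + (a + b) * (d * mb) + r * (a * mb)"
    unfolding d r by (simp add: algebra_simps)
  moreover have "r * (a * mb) \<le> r * (b * ma)" using 1 by simp
  moreover have "(a + b) * (d * mb) \<le> (a + b) * (b * (e + 1))" using 2 by (rule mult_le_mono2)
  ultimately have "b * (s * (ma + mb)) \<le> (a + b) * (b * ma) + (a + b) * (b * (e + 1))" by linarith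
  also have "\<dots> = b * ((a + b) * (ma + e + 1))" by (simp add: algebra_simps)
  finally show ?thesis using \<open>0 < b\<close> by simp
qed

text \<open>Induction on the number of vertices. If no edge-respecting split of \<open>B\<close>
  exists, \<open>connected_spanned\<close> suffices because the density is at most 1. Otherwise one
  side of the split has at least average density and is filled first.\<close>

lemma dense_spanned:
  assumes "finite A" "finite B"
    and "\<And>u. u \<in> A \<Longrightarrow> f u \<subseteq> B \<and> f u \<noteq> {} \<and> card (f u) \<le> 2"
    and "card A \<le> card B" and "s \<le> card B"
  shows "\<exists>S\<subseteq>B. card S = s \<and> s * card A \<le> card B * (card (spanned A f S) + 1)"
  using assms
proof (induction "card B" arbitrary: A B s rule: less_induct)
  case less
  note fin = less.prems(1,2) and size = less.prems(3)
  show ?case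
  proof (cases "\<exists>T\<subseteq>B. T \<noteq> {} \<and> T \<noteq> B \<and> (\<forall>u\<in>A. f u \<subseteq> T \<or> f u \<subseteq> B - T)")
    case False
    obtain S where S: "S \<subseteq> B" "card S = s" "s \<le> card (spanned A f S) + 1"
      using connected_spanned[OF fin, of f s] size less.prems(5) False by metis
    have "s * card A \<le> (card (spanned A f S) + 1) * card B"
      using S(3) less.prems(4) by (rule mult_le_mono)
    then show ?thesis using S by (auto simp: mult.commute)
  next
    case True
    \<comment> \<open>Stated for an arbitrary side \<open>T\<close> of at least average density, so
      that it can serve for either side of a split.\<close>
    have split: ?thesis
      if T: "T \<subseteq> B" "T \<noteq> {}" "T \<noteq> B" "\<forall>u\<in>A. f u \<subseteq> T \<or> f u \<subseteq> B - T"
        and dense: "card T * card A \<le> card B * card (spanned A f T)" for T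
    proof -
      let ?a = "card T" and ?b = "card (B - T)"
      let ?ma = "card (spanned A f T)" and ?mb = "card (spanned A f (B - T))"
      have finT: "finite T" using T(1) fin finite_subset by blast
      have B: "card B = ?a + ?b"
        using card_Un_disjoint[of T "B - T"] T(1) fin finT by (simp add: Un_absorb1)
      have a: "?a > 0" using T finT by (simp add: card_gt_0_iff)
      have b: "?b > 0" using T fin by (auto simp: card_gt_0_iff)
      \<comment> \<open>Edges are nonempty, so none lies in both sides.\<close>
      have disj: "spanned A f T \<inter> spanned A f (B - T) = {}"
        using size by (fastforce simp: spanned_def)
      have "A = spanned A f T \<union> spanned A f (B - T)"
        using T(4) by (auto simp: spanned_def)
      then have A: "card A = ?ma + ?mb"
        using card_Un_disjoint[OF _ _ disj] fin(1) finite_spanned by metis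
      show ?thesis
      proof (cases "s \<le> ?a")
        case True
        \<comment> \<open>\<open>T\<close> may span more edges than it has vertices, which the
          induction hypothesis forbids. Keeping only \<open>?a\<close> of them leaves density 1,
          still at least the average since \<open>card A\<close> \<le>
          \<open>card B\<close>.\<close>
        obtain A' where A': "A' \<subseteq> spanned A f T" "card A' = min ?ma ?a"
          using obtain_subset_with_card_n[of "min ?ma ?a" "spanned A f T"] by auto
        have A'A: "A' \<subseteq> A" using A' spanned_subset by fast
        obtain S where S: "S \<subseteq> T" "card S = s"
            "s * card A' \<le> ?a * (card (spanned A' f S) + 1)"
        proof -
          have "f u \<subseteq> T \<and> f u \<noteq> {} \<and> card (f u) \<le> 2" if "u \<in> A'" for u
            using that A'(1) size A'A by (auto simp: spanned_def)
          then show ?thesis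
            using less.hyps[of T A' s] B b A' finT A'A fin(1) finite_subset[of A' A] True that
            by auto
        qed
        have "card (spanned A' f S) \<le> card (spanned A f S)"
          by (rule card_mono[OF finite_spanned[OF fin(1)]]) (use A'A in \<open>auto simp: spanned_def\<close>)
        then have "?a * (card (spanned A' f S) + 1) \<le> ?a * (card (spanned A f S) + 1)" by simp
        with S(3) have 1: "s * card A' \<le> ?a * (card (spanned A f S) + 1)" by linarith
        have "?a * card A \<le> card B * card A'"
          using dense less.prems(4) A'(2) by (auto simp: min_def mult.commute)
        then have "s * (?a * card A) \<le> s * (card B * card A')" by (rule mult_le_mono2)
        also have "\<dots> = card B * (s * card A')" by simp
        also have "\<dots> \<le> card B * (?a * (card (spanned A f S) + 1))"
          using 1 by (rule mult_le_mono2)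
        finally have "?a * (s * card A) \<le> ?a * (card B * (card (spanned A f S) + 1))"
          by (simp only: ac_simps)
        then have "s * card A \<le> card B * (card (spanned A f S) + 1)" using a by simp
        then show ?thesis using S T(1) by blast
      next
        case False
        \<comment> \<open>The complement has at most average density, hence at most 1, so the
          induction hypothesis applies to it with all its edges.\<close>
        have "card B * ?mb \<le> ?b * card A"
          using dense unfolding A B by (simp add: algebra_simps)
        also have "\<dots> \<le> ?b * card B" using less.prems(4) by simp
        finally have mb: "?mb \<le> ?b" using B b by (simp add: mult.commute)
        have "\<exists>S\<subseteq>B - T. card S = s - ?a \<and>
            (s - ?a) * ?mb \<le> ?b * (card (spanned (spanned A f (B - T)) f S) + 1)"
        proof (rule less.hyps)
          show "?b < card B" using B a by simp
          show "finite (spanned A f (B - T))" using fin(1) by (rule finite_spanned)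
          show "finite (B - T)" using fin by simp
          show "f u \<subseteq> B - T \<and> f u \<noteq> {} \<and> card (f u) \<le> 2" if "u \<in> spanned A f (B - T)" for u
            using that size by (auto simp: spanned_def)
          show "?mb \<le> ?b" by (rule mb)
          show "s - ?a \<le> ?b" using less.prems(5) B by simp
        qed
        then obtain S where S: "S \<subseteq> B - T" "card S = s - ?a"
          "(s - ?a) * ?mb \<le> ?b * (card (spanned (spanned A f (B - T)) f S) + 1)" by blast
        let ?e = "card (spanned (spanned A f (B - T)) f S)"
        have finS: "finite S" using S(1) fin finite_subset by blast
        have "spanned A f T \<inter> spanned (spanned A f (B - T)) f S = {}"
          using disj by (auto simp: spanned_def)
        then have "?ma + ?e = card (spanned A f T \<union> spanned (spanned A f (B - T)) f S)"
          using fin(1) by (simp add: card_Un_disjoint finite_spanned)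
        also have "\<dots> \<le> card (spanned A f (T \<union> S))"
          by (rule card_mono[OF finite_spanned[OF fin(1)]]) (auto simp: spanned_def)
        finally have e: "?ma + ?e + 1 \<le> card (spanned A f (T \<union> S)) + 1" by simp
        have "s * card A \<le> card B * (?ma + ?e + 1)"
          unfolding A B
          by (rule interpolation_arith)
            (use dense S(3) b False less.prems(5) A B in simp_all)
        also have "\<dots> \<le> card B * (card (spanned A f (T \<union> S)) + 1)"
          using e by (rule mult_le_mono2)
        finally have "s * card A \<le> card B * (card (spanned A f (T \<union> S)) + 1)" .
        moreover have "card (T \<union> S) = s"
          using card_Un_disjoint[OF finT finS] S False by auto
        ultimately show ?thesis using S(1) T(1) by (intro exI[of _ "T \<union> S"]) auto
      qed
    qed
    obtain T where T: "T \<subseteq> B" "T \<noteq> {}" "T \<noteq> B" "\<forall>u\<in>A. f u \<subseteq> T \<or> f u \<subseteq> B - T"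
      using True by blast
    show ?thesis
    proof (cases "card T * card A \<le> card B * card (spanned A f T)")
      case True
      then show ?thesis using split T by blast
    next
      \<comment> \<open>The two sides together carry all vertices and all edges, so if
        \<open>T\<close> is below average its complement is above.\<close>
      case False
      have finT: "finite T" using T(1) fin finite_subset by blast
      have B: "card B = card T + card (B - T)"
        using card_Un_disjoint[of T "B - T"] T(1) fin finT by (simp add: Un_absorb1)
      have "A = spanned A f T \<union> spanned A f (B - T)"
        using T(4) by (auto simp: spanned_def)
      then have "card A \<le> card (spanned A f T) + card (spanned A f (B - T))"
        using card_Un_le by metis
      then have "card B * card A
          \<le> card B * card (spanned A f T) + card B * card (spanned A f (B - T))"
        by (metis add_mult_distrib2 mult_le_mono2)
      moreover have "card B * card A = card T * card A + card (B - T) * card A"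
        using B by (metis add_mult_distrib)
      ultimately have "card (B - T) * card A \<le> card B * card (spanned A f (B - T))"
        using False by linarith
      then show ?thesis
        using split[of "B - T"] T by (auto simp: double_diff)
    qed
  qed
qed

section \<open>From spanning sets to biholes\<close>

definition neighbours :: "'a set set \<Rightarrow> 'a set \<Rightarrow> 'a \<Rightarrow> 'a set" where
  "neighbours E B u = {b \<in> B. {u, b} \<in> E}"

lemma degree_eq_card_neighbours:
  assumes "bipartite_graph A B E" "u \<in> A"
  shows "degree E u = card (neighbours E B u)"
proof -
  have disj: "A \<inter> B = {}" and ab: "\<And>e. e \<in> E \<Longrightarrow> \<exists>a\<in>A. \<exists>b\<in>B. e = {a, b}"
    using assms(1) by (auto simp: bipartite_graph_def)
  have "{e \<in> E. u \<in> e} = (\<lambda>b. {u, b}) ` neighbours E B u" (is "?L = ?R")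
  proof
    show "?L \<subseteq> ?R"
    proof
      fix e assume e: "e \<in> ?L"
      then obtain a b where "a \<in> A" "b \<in> B" "e = {a, b}" using ab by blast
      then show "e \<in> ?R" using e assms(2) disj by (auto simp: neighbours_def)
    qed
  qed (auto simp: neighbours_def)
  moreover have "inj_on (\<lambda>b. {u, b}) (neighbours E B u)"
    by (auto simp: inj_on_def doubleton_eq_iff)
  ultimately show ?thesis by (simp add: degree_def card_image)
qed

text \<open>A vertex of \<open>A\<close> whose neighbourhood lies in \<open>S\<close> has no
  neighbour in \<open>B - S\<close>; any \<open>k\<close> vertices of each kind form the
  bihole.\<close>

lemma has_biholeI:
  assumes bg: "bipartite_graph A B E"
    and "S \<subseteq> B" "k \<le> card B - card S" "k \<le> card (spanned A (neighbours E B) S)"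
  shows "has_bihole A B E k"
proof -
  have fin: "finite B" and disj: "A \<inter> B = {}"
    and ab: "\<And>e. e \<in> E \<Longrightarrow> \<exists>a\<in>A. \<exists>b\<in>B. e = {a, b}"
    using bg by (auto simp: bipartite_graph_def simple_graph_def)
  have "k \<le> card (B - S)"
    using assms(2,3) fin by (simp add: card_Diff_subset finite_subset)
  then obtain Y where Y: "Y \<subseteq> B - S" "card Y = k" by (rule obtain_subset_with_card_n)
  obtain X where X: "X \<subseteq> spanned A (neighbours E B) S" "card X = k"
    using obtain_subset_with_card_n[OF assms(4)] by blast
  have XA: "X \<subseteq> A" using X(1) spanned_subset by fast
  have "\<not> e \<subseteq> X \<union> Y" if e: "e \<in> E" for e
  proof
    assume sub: "e \<subseteq> X \<union> Y"
    obtain a b where p: "a \<in> A" "b \<in> B" "e = {a, b}" using ab[OF e] by blast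
    then have "a \<in> X" "b \<in> Y" using sub XA Y disj by auto
    moreover have "b \<in> neighbours E B a" using p e by (simp add: neighbours_def)
    ultimately show False using X(1) Y(1) by (auto simp: spanned_def)
  qed
  moreover have "(X \<union> Y) \<inter> A = X" "(X \<union> Y) \<inter> B = Y" using XA Y(1) disj by auto
  ultimately show ?thesis
    unfolding has_bihole_def independent_set_def using X Y XA by (intro exI[of _ "X \<union> Y"]) auto
qed

text \<open>Here \<open>e\<close> is the number of edges spanned by \<open>N - k\<close> vertices.
  If \<open>k\<close> exceeded \<open>n0 + e\<close>, the density bound would give
  \<open>N * N\<close> \<le> \<open>k * (2 * N - n0)\<close>. But \<open>4 * k\<close> \<le>
  \<open>2 * N + n0 - 4\<close>, and \<open>(2 * N + n0) * (2 * N - n0)\<close> is at most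
  \<open>4 * (N * N)\<close>.\<close>

lemma bihole_order_arith:
  fixes n0 m k e :: nat
  assumes "4 * k + 4 \<le> 3 * n0 + 2 * m" "0 < k"
    and "(n0 + m - k) * m \<le> (n0 + m) * (e + 1)"
  shows "k \<le> n0 + e"
proof (rule ccontr)
  assume "\<not> k \<le> n0 + e"
  then have ek: "int e + 1 \<le> int k - int n0" by simp
  define N where "N = int n0 + int m"
  have kN: "k \<le> n0 + m" using assms by simp
  have "(N - int k) * (N - int n0) \<le> N * (int e + 1)"
  proof -
    have "int ((n0 + m - k) * m) \<le> int ((n0 + m) * (e + 1))"
      using assms(3) by (simp only: of_nat_le_iff)
    then show ?thesis using kN by (simp add: N_def of_nat_diff distrib_left)
  qed
  also have "\<dots> \<le> N * (int k - int n0)"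
    using ek by (rule mult_left_mono) (simp add: N_def)
  finally have 1: "N * N \<le> int k * (2 * N - int n0)" by (simp add: algebra_simps)
  have "4 * int k \<le> 2 * N + int n0 - 4" using assms(1) by (simp add: N_def)
  then have "(4 * int k) * (2 * N - int n0) \<le> (2 * N + int n0 - 4) * (2 * N - int n0)"
    by (rule mult_right_mono) (simp add: N_def)
  also have "\<dots> = 4 * (N * N) - int n0 * int n0 - 8 * N + 4 * int n0"
    by (simp add: algebra_simps)
  \<comment> \<open>Strictness comes from the \<open>4\<close> in the hypothesis on
    \<open>k\<close>: it contributes \<open>- 8 * N + 4 * n0\<close>, which is negative.\<close>
  also have "\<dots> < 4 * (N * N)"
  proof -
    have "0 \<le> int n0 * int n0" by simp
    moreover have "int n0 \<le> N" "0 < N" using assms by (auto simp: N_def)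
    ultimately show ?thesis by linarith
  qed
  finally show False using 1 by simp
qed

lemma realizes_has_bihole:
  assumes r: "realizes A B E [(0, n0), (1, n1), (2, n2)]"
    and k: "4 * k + 4 \<le> 3 * n0 + 2 * (n1 + n2)" "0 < k"
  shows "has_bihole A B E k"
proof -
  have bg: "bipartite_graph A B E"
    and cA: "card A = n0 + (n1 + n2)" and cB: "card B = n0 + (n1 + n2)"
    and c0: "card {u\<in>A. degree E u = 0} = n0" and c1: "card {u\<in>A. degree E u = 1} = n1"
    and c2: "card {u\<in>A. degree E u = 2} = n2"
    using r by (auto simp: realizes_def)
  have fin: "finite A" "finite B" using bg by (auto simp: bipartite_graph_def simple_graph_def)
  let ?f = "neighbours E B"
  \<comment> \<open>Only \<open>P\<close> supplies edges to \<open>dense_spanned\<close>, which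
    excludes empty ones. The vertices in \<open>Z\<close> have neighbourhood \<open>{}\<close>, lie
    in \<open>spanned A ?f S\<close> for every \<open>S\<close>, and so contribute \<open>n0\<close>
    at the end.\<close>
  define Z where "Z = {u\<in>A. degree E u = 0}"
  define P where "P = {u\<in>A. degree E u = 1} \<union> {u\<in>A. degree E u = 2}"
  have finZP: "finite Z" "finite P" using fin by (auto simp: Z_def P_def)
  have cP: "card P = n1 + n2"
    unfolding P_def by (subst card_Un_disjoint) (use fin c1 c2 in auto)
  have "f \<subseteq> B \<and> f \<noteq> {} \<and> card f \<le> 2" if "u \<in> P" "f = ?f u" for u f
  proof -
    have "card f = 1 \<or> card f = 2"
      using that degree_eq_card_neighbours[OF bg] by (auto simp: P_def)
    then have "f \<noteq> {}" "card f \<le> 2" by auto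
    then show ?thesis using that by (auto simp: neighbours_def)
  qed
  then obtain S where S: "S \<subseteq> B" "card S = card B - k"
      "(card B - k) * card P \<le> card B * (card (spanned P ?f S) + 1)"
    using dense_spanned[of P B ?f "card B - k"] finZP fin cP cB by auto
  have "k \<le> n0 + card (spanned P ?f S)"
    using bihole_order_arith[OF k] S(3) unfolding cP cB by blast
  also have "\<dots> = card (Z \<union> spanned P ?f S)"
    using c0 finZP
    by (subst card_Un_disjoint) (auto simp: Z_def P_def spanned_def)
  also have "\<dots> \<le> card (spanned A ?f S)"
  proof (rule card_mono[OF finite_spanned[OF fin(1)]])
    have "?f u = {}" if "u \<in> Z" for u
    proof -
      have "card (?f u) = 0" using that degree_eq_card_neighbours[OF bg, of u] by (simp add: Z_def)
      moreover have "finite (?f u)" using fin by (simp add: neighbours_def)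
      ultimately show ?thesis by simp
    qed
    then show "Z \<union> spanned P ?f S \<subseteq> spanned A ?f S"
      by (auto simp: spanned_def Z_def P_def)
  qed
  finally have "k \<le> card (spanned A ?f S)" .
  then show ?thesis using has_biholeI[OF bg S(1)] S(2) k cB by simp
qed

section \<open>Realizability and the bound on \<open>alpha_tilde\<close>\<close>

text \<open>Used to bound the admissible bihole orders, since without a realization every
  \<open>k\<close> would qualify. Two vertices in \<open>B\<close> are enough to serve as
  neighbours.\<close>

lemma exists_realization:
  assumes "2 \<le> n0 + n1 + n2"
  shows "\<exists>(A :: nat set) B E. realizes A B E [(0, n0), (1, n1), (2, n2)]"
proof -
  define n where "n = n0 + n1 + n2"
  define A B where "A = {..<n}" and "B = {n..<2 * n}"
  \<comment> \<open>Every vertex of positive degree is joined to \<open>n\<close>, and those of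
    degree 2 also to \<open>n + 1\<close>.\<close>
  define E where "E = (\<lambda>u. {u, n}) ` {n0..<n} \<union> (\<lambda>u. {u, n + 1}) ` {n0 + n1..<n}"
  have E: "\<exists>a\<in>A. \<exists>b\<in>B. e = {a, b}" if "e \<in> E" for e
  proof -
    have "n \<in> B" "n + 1 \<in> B" using assms by (auto simp: B_def n_def)
    moreover have "{n0..<n} \<subseteq> A" "{n0 + n1..<n} \<subseteq> A" by (auto simp: A_def)
    ultimately show ?thesis using that unfolding E_def by blast
  qed
  have bg: "bipartite_graph A B E"
    unfolding bipartite_graph_def simple_graph_def
  proof (intro conjI ballI)
    fix e assume "e \<in> E"
    then obtain a b where "a \<in> A" "b \<in> B" "e = {a, b}" using E by blast
    then show "e \<subseteq> A \<union> B" "card e = 2" by (auto simp: A_def B_def)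
    show "\<exists>a\<in>A. \<exists>b\<in>B. e = {a, b}" using \<open>e \<in> E\<close> by (rule E)
  qed (auto simp: A_def B_def)
  have nb: "neighbours E B u =
      (if u < n0 then {} else if u < n0 + n1 then {n} else {n, n + 1})" if "u \<in> A" for u
    using that assms by (auto simp: neighbours_def E_def A_def B_def doubleton_eq_iff n_def)
  have deg: "degree E u = (if u < n0 then 0 else if u < n0 + n1 then 1 else 2)" if "u \<in> A" for u
    using degree_eq_card_neighbours[OF bg that] nb[OF that] by simp
  have "{u\<in>A. degree E u = 0} = {..<n0}" "{u\<in>A. degree E u = 1} = {n0..<n0 + n1}"
    "{u\<in>A. degree E u = 2} = {n0 + n1..<n}"
    using deg by (auto simp: A_def n_def split: if_splits)
  then have "realizes A B E [(0, n0), (1, n1), (2, n2)]"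
    using bg by (simp add: realizes_def A_def B_def n_def)
  then show ?thesis by blast
qed

theorem theorem3:
  fixes n0 n1 n2 :: nat
  shows "real (alpha_tilde [(0, n0), (1, n1), (2, n2)])
           \<ge> 3 / 4 * real n0 + 1 / 2 * (real n1 + real n2) - 7 / 4"
proof -
  \<comment> \<open>When the subtraction is not truncated, this is the largest \<open>k\<close>
    allowed by \<open>realizes_has_bihole\<close>. The \<open>4\<close> there costs 1 and rounding
    down at most 3/4, together 7/4.\<close>
  define k where "k = (3 * n0 + 2 * (n1 + n2) - 4) div 4"
  have "3 * n0 + 2 * (n1 + n2) \<le> 4 * k + 7" unfolding k_def by linarith
  then have "real (3 * n0 + 2 * (n1 + n2)) \<le> real (4 * k + 7)" by (simp only: of_nat_le_iff)
  then have bound: "3 / 4 * real n0 + 1 / 2 * (real n1 + real n2) - 7 / 4 \<le> real k"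
    by (simp add: field_simps)
  show ?thesis
  proof (cases "k = 0")
    \<comment> \<open>The claimed bound is then at most 0 and holds for any natural number, even the
      unspecified value of an unrealizable sequence.\<close>
    case True
    then show ?thesis using bound by linarith
  next
    case False
    let ?ds = "[(0, n0), (1, n1), (2, n2)]"
    let ?P = "\<lambda>k. \<forall>(A :: nat set) B E. realizes A B E ?ds \<longrightarrow> has_bihole A B E k"
    have k4: "4 * k + 4 \<le> 3 * n0 + 2 * (n1 + n2)" using False unfolding k_def by linarith
    then have "?P k" using realizes_has_bihole False by blast
    \<comment> \<open>An upper bound on the admissible orders makes \<open>GREATEST\<close> an
      actual maximum.\<close>
    moreover have "j \<le> n0 + n1 + n2" if "?P j" for j
    proof -
      have "2 \<le> n0 + n1 + n2" using k4 \<open>k \<noteq> 0\<close> by presburger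
      then obtain A B :: "nat set" and E where r: "realizes A B E ?ds"
        using exists_realization by blast
      then obtain I where "card (I \<inter> A) = j" using \<open>?P j\<close> unfolding has_bihole_def by blast
      moreover have "finite A" "card A = n0 + n1 + n2"
        using r by (auto simp: realizes_def bipartite_graph_def simple_graph_def)
      ultimately show ?thesis by (metis card_mono inf_le2)
    qed
    ultimately have "k \<le> alpha_tilde ?ds"
      unfolding alpha_tilde_def by (intro Greatest_le_nat[where P = ?P]) auto
    then show ?thesis using bound by linarith
  qed
qed

end
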